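(* Let $p$ be a prime greater than $13$, $m\ge1$, $q=p^m$, and $a\in\mathbb{F}_q$. If $K_q(a)=1-\frac{2}{\zeta+\zeta^{-1}}$, then, in $\mathbb{F}_p$, $$\mathrm{Tr}^m_1(a)=-\tfrac12,\quad\mathrm{Tr}^m_1(a^2)=-\tfrac13,\quad\mathrm{Tr}^m_1(a^3)=-\tfrac15,\quad\mathrm{Tr}^m_1(a^4)=-\tfrac{136}{1155},$$ and moreover $$\sum_{0\le i<j\le m-1}a^{p^i+p^j}=\tfrac{7}{24},\quad\sum_{0\le i<j<k\le m-1}a^{p^i+p^j+p^k}=-\tfrac{41}{240},\quad\sum_{0\le i<j<k<l\le m-1}a^{p^i+p^j+p^k+p^l}=\tfrac{8879}{88704}.$$
   Context: $\zeta=e^{2\pi\sqrt{-1}/p}$, $\mathrm{Tr}^m_1(x)=\sum_{k=0}^{m-1}x^{p^k}$ is the trace from $\mathbb{F}_q$ to $\mathbb{F}_p$ (for $c\in\mathbb{F}_p$, $\zeta^c$ means $\zeta$ to any integer representative of $c$), and the Kloosterman sum of $a\in\mathbb{F}_q$ is $K_q(a)=\sum_{x\in\mathbb{F}_q}\zeta^{\mathrm{Tr}^m_1(x^{q-2}+ax)}$. Rational numbers with denominators prime to $p$ are interpreted as elements of $\mathbb{F}_p$. *)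

theory Defs
  imports Complex_Main "HOL-Computational_Algebra.Primes"
begin

text \<open>The finite field F_q (q = p^m) is modelled by an arbitrary finite field type 'a
  with CARD('a) = p^m; all such fields are isomorphic.\<close>

definition trace :: "nat \<Rightarrow> nat \<Rightarrow> 'a::field \<Rightarrow> 'a" where
  "trace p m x = (\<Sum>k<m. x ^ (p ^ k))"

definition zeta :: "nat \<Rightarrow> complex" where
  "zeta p = cis (2 * pi / real p)"

definition fp_rep :: "nat \<Rightarrow> 'a::field \<Rightarrow> nat" where
  "fp_rep p c = (LEAST k. k < p \<and> of_nat k = c)"

definition kloosterman :: "nat \<Rightarrow> nat \<Rightarrow> 'a::{field,finite} \<Rightarrow> complex" where
  "kloosterman p m a =
     (\<Sum>x\<in>(UNIV::'a set). zeta p ^ fp_rep p (trace p m (x ^ (card (UNIV::'a set) - 2) + a * x)))"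

end

theory Submission
  imports Defs "HOL-Computational_Algebra.Polynomial_Factorial" "HOL-Library.FuncSet"
    "HOL-Number_Theory.Cong"
begin

text \<open>
  Put \<open>T x = Tr (1/x + a x)\<close> and \<open>M\<^sub>k = (\<Sum>x. (T x)\<^sup>k)\<close>, computed in \<open>\<F>\<^sub>q\<close>. Clearing denominators,
  the hypothesis is a \<open>\<int>\<close>-linear relation between powers of \<open>\<zeta>\<close>, i.e. an integer polynomial
  divisible by the (irreducible) cyclotomic polynomial \<open>1 + X + \<dots> + X\<^bsup>p-1\<^esup>\<close>. As
  \<open>\<Sum>c\<in>\<F>\<^sub>p. c\<^sup>k\<close> vanishes for \<open>k < p - 1\<close>, weighting the coefficient of \<open>X\<^sup>c\<close> with \<open>c\<^sup>k\<close> gives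
  \<open>(\<Sum>x. (T x + 1)\<^sup>k + (T x - 1)\<^sup>k) = 1 + (-1)\<^sup>k - 2 0\<^sup>k\<close>, so that \<open>M\<^sub>2, M\<^sub>4, M\<^sub>6, M\<^sub>8\<close> are, up to
  sign, the Euler numbers.
  On the other hand, \<open>T x\<close> is the sum of the \<open>a\<^sub>i x\<^sub>i + 1/x\<^sub>i\<close> with \<open>x\<^sub>i = x\<close> to the power \<open>p\<^sup>i\<close>
  and \<open>a\<^sub>i = a\<close> to the power \<open>p\<^sup>i\<close>. For \<open>2 k < p\<close> the monomials in the \<open>x\<^sub>i\<close> occurring in
  \<open>(T x)\<^sup>k\<close> have exponents in \<open>x\<close> too small to be divisible by \<open>q - 1\<close> unless they are constant.
  Hence \<open>-M\<^sub>k\<close> is the constant term of \<open>(T x)\<^sup>k\<close> as a Laurent polynomial in the \<open>x\<^sub>i\<close>, which is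
  a polynomial in the power sums of the \<open>a\<^sub>i\<close>; solving for these gives the traces, and Newton's
  identities give the elementary symmetric functions.
\<close>

section \<open>Irreducibility of the prime cyclotomic polynomials\<close>

text \<open>At the first index \<open>k\<close> where \<open>q\<close> misses a coefficient of
  \<open>g\<close>, it also misses \<open>coeff f k\<close>; hence
  \<open>degree f \<le> k \<le> degree g\<close>.\<close>

lemma eisenstein_factor_degree:
  fixes f g h :: "'a::idom poly"
  assumes q: "prime_elem q" and f: "f = g * h"
    and low: "\<And>i. i < degree f \<Longrightarrow> q dvd coeff f i"
    and lead: "\<not> q dvd lead_coeff f" and h0: "\<not> q dvd coeff h 0"
  shows "degree h = 0"
proof -
  have nz: "g \<noteq> 0" "h \<noteq> 0"
    using h0 lead f by auto
  have "\<not> q dvd lead_coeff g"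
    using lead by (auto simp: f lead_coeff_mult)
  define k where "k = (LEAST i. \<not> q dvd coeff g i)"
  have k: "\<not> q dvd coeff g k" and k_le: "k \<le> degree g"
    using \<open>\<not> q dvd lead_coeff g\<close> unfolding k_def by (rule LeastI, rule Least_le)
  have "q dvd coeff g i" if "i < k" for i
    using that not_less_Least unfolding k_def by blast
  then have "q dvd (\<Sum>i<k. coeff g i * coeff h (k - i))"
    by (auto intro!: dvd_sum)
  moreover have "\<not> q dvd coeff g k * coeff h 0"
    using k h0 q by (simp add: prime_elem_dvd_mult_iff)
  ultimately have "\<not> q dvd (\<Sum>i<k. coeff g i * coeff h (k - i)) + coeff g k * coeff h 0"
    by (simp add: dvd_add_right_iff)
  then have "\<not> q dvd coeff f k"
    by (simp add: f coeff_mult lessThan_Suc_atMost[symmetric])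
  then have "degree f \<le> k"
    using low not_le by blast
  then show ?thesis
    using k_le nz by (simp add: f degree_mult_eq)
qed

text \<open>As \<open>q ^ 2\<close> misses the constant coefficient, \<open>q\<close> misses that of
  one factor, which is then constant; constants dividing a polynomial of content 1 are
  units.\<close>

theorem eisenstein:
  fixes f :: "'a::{factorial_ring_gcd,semiring_gcd_mult_normalize} poly"
  assumes q: "prime_elem q" and f: "content f = 1" "degree f > 0"
    and low: "\<And>i. i < degree f \<Longrightarrow> q dvd coeff f i"
    and lead: "\<not> q dvd lead_coeff f" and q2: "\<not> q ^ 2 dvd coeff f 0"
  shows "irreducible f"
proof (rule irreducibleI)
  show "f \<noteq> 0" "\<not> is_unit f"
    using f by (auto simp: is_unit_poly_iff)
next
  fix g h assume fgh: "f = g * h"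
  have unit: "is_unit c" if "degree c = 0" "c dvd f" for c
  proof -
    obtain d where d: "c = [:d:]"
      using \<open>degree c = 0\<close> degree_eq_zeroE by blast
    then have "d dvd content f"
      using that by (simp add: const_poly_dvd_iff_dvd_content)
    then show ?thesis
      using f d by (simp add: is_unit_poly_iff)
  qed
  have "coeff f 0 = coeff g 0 * coeff h 0"
    by (simp add: fgh coeff_mult)
  then have "\<not> (q dvd coeff g 0 \<and> q dvd coeff h 0)"
    using q2 by (auto simp: power2_eq_square intro: mult_dvd_mono)
  then have "degree g = 0 \<or> degree h = 0"
    using eisenstein_factor_degree[OF q fgh low lead]
      eisenstein_factor_degree[OF q _ low lead, of h g] fgh by (auto simp: mult.commute)
  then show "is_unit g \<or> is_unit h"
    using unit fgh by auto
qed

definition prime_cyclotomic :: "nat \<Rightarrow> int poly" where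
  "prime_cyclotomic p = (\<Sum>i<p. monom 1 i)"

text \<open>Multiplied by \<open>X\<close>, the left side becomes \<open>(X + 1) ^ p - 1\<close>,
  which the binomial theorem expands.\<close>

lemma prime_cyclotomic_shift:
  assumes "p > 0"
  shows "prime_cyclotomic p \<circ>\<^sub>p [:1, 1:] = (\<Sum>k<p. monom (int (p choose Suc k)) k)"
proof -
  have mon: "monom 1 i \<circ>\<^sub>p [:1, 1:] = [:1, 1:] ^ i" for i :: nat
    by (induction i) (simp_all add: monom_Suc pcompose_pCons pcompose_1 monom_0)
  have X: "[:0, 1::int:] = [:1, 1:] - 1"
    by (simp add: one_pCons)
  have "[:0, 1:] * (prime_cyclotomic p \<circ>\<^sub>p [:1, 1:]) = [:1, 1:] ^ p - 1"
    unfolding prime_cyclotomic_def pcompose_sum mon X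
    by (rule power_diff_1_eq[symmetric])
  also have "[:1, 1:] ^ p = (monom (1::int) 1 + 1) ^ p"
    by (simp add: monom_altdef one_pCons)
  also have "\<dots> = (\<Sum>k\<le>p. of_nat (p choose k) * monom 1 1 ^ k * 1 ^ (p - k))"
    by (rule binomial_ring)
  also have "\<dots> = (\<Sum>k\<le>p. monom (int (p choose k)) k)"
    by (intro sum.cong) (auto simp: monom_power of_nat_monom mult_monom)
  also have "\<dots> = 1 + (\<Sum>k<p. monom (int (p choose Suc k)) (Suc k))"
    by (simp add: lessThan_Suc_atMost[symmetric] sum.lessThan_Suc_shift monom_0 one_pCons del: sum.lessThan_Suc)
  also have "\<dots> - 1 = [:0, 1:] * (\<Sum>k<p. monom (int (p choose Suc k)) k)"
    by (simp add: monom_Suc sum_distrib_left)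
  finally show ?thesis
    unfolding mult_cancel_left by simp
qed

text \<open>The shift by 1 makes Eisenstein's criterion applicable at \<open>p\<close>, the constant
  coefficient becoming \<open>p\<close> itself. A factorisation shifts along, and units shift back
  because composition preserves degrees.\<close>

lemma irreducible_prime_cyclotomic:
  assumes "prime p"
  shows "irreducible (prime_cyclotomic p)"
proof -
  define E where "E = prime_cyclotomic p \<circ>\<^sub>p [:1, 1:]"
  have p: "p > 1"
    using assms prime_gt_1_nat by blast
  have coeff_E: "coeff E k = (if k < p then int (p choose Suc k) else 0)" for k
    using p by (simp add: E_def prime_cyclotomic_shift coeff_sum)
  have deg: "degree E = p - 1"
  proof (rule antisym)
    show "degree E \<le> p - 1"
      by (rule degree_le) (auto simp: coeff_E)
    show "p - 1 \<le> degree E"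
      by (rule le_degree) (use p in \<open>auto simp: coeff_E\<close>)
  qed
  have lead: "lead_coeff E = 1"
    using p by (simp add: deg coeff_E)
  have "irreducible E"
  proof (rule eisenstein)
    show "prime_elem (int p)"
      using assms by simp
    show "content E = 1"
      using lead content_dvd_coeff[of E "degree E"] by (metis is_unit_content_iff)
    show "degree E > 0"
      using p deg by simp
    show "int p dvd coeff E i" if "i < degree E" for i
      using that p assms by (auto simp: coeff_E deg intro!: dvd_choose_prime)
    show "\<not> int p dvd lead_coeff E"
      using p lead by auto
    show "\<not> (int p)\<^sup>2 dvd coeff E 0"
      using p by (auto simp: coeff_E power2_eq_square dest: zdvd_imp_le)
  qed
  show ?thesis
  proof (rule irreducibleI)
    show "prime_cyclotomic p \<noteq> 0"
      using \<open>irreducible E\<close> by (auto simp: E_def)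
    show "\<not> is_unit (prime_cyclotomic p)"
      using \<open>irreducible E\<close> by (auto simp: E_def is_unit_poly_iff irreducible_def)
    fix g h assume gh: "prime_cyclotomic p = g * h"
    have unit: "is_unit c" if "is_unit (c \<circ>\<^sub>p [:1, 1::int:])" for c
    proof -
      have "degree (c \<circ>\<^sub>p [:1, 1:]) = 0"
        using that by (auto simp: is_unit_poly_iff)
      then have "degree c = 0"
        by (simp add: degree_pcompose)
      then obtain d where "c = [:d:]"
        by (rule degree_eq_zeroE)
      then show ?thesis
        using that by simp
    qed
    have "E = (g \<circ>\<^sub>p [:1, 1:]) * (h \<circ>\<^sub>p [:1, 1:])"
      by (simp add: E_def gh pcompose_mult)
    then show "is_unit g \<or> is_unit h"
      using \<open>irreducible E\<close> unit by (auto simp: irreducible_def)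
  qed
qed

section \<open>Divisibility from vanishing at a root of unity\<close>

lemma map_poly_of_int_add:
  "map_poly of_int (f + g) = (map_poly of_int f + map_poly of_int g :: 'a::ring_1 poly)"
  by (rule poly_eqI) (simp add: coeff_map_poly)

lemma map_poly_of_int_mult:
  "map_poly of_int (f * g) = (map_poly of_int f * map_poly of_int g :: 'a::comm_ring_1 poly)"
  by (rule poly_eqI) (simp add: coeff_map_poly coeff_mult)

lemma map_poly_of_int_smult:
  "map_poly of_int (smult c f) = (smult (of_int c) (map_poly of_int f) :: 'a::comm_ring_1 poly)"
  by (rule poly_eqI) (simp add: coeff_map_poly)

text \<open>Pseudo-division replaces rational coefficients: a polynomial \<open>m\<close> of least
  degree vanishing at \<open>z\<close> divides a nonzero multiple of every other one, and the prime
  \<open>f\<close> turns out to divide \<open>m\<close>.\<close>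

lemma prime_elem_dvd_of_common_root:
  fixes f g :: "int poly" and z :: "'a::field_char_0"
  assumes f: "prime_elem f" "degree f > 0" "poly (map_poly of_int f) z = 0"
    and g: "poly (map_poly of_int g) z = 0"
  shows "f dvd g"
proof -
  have "f \<noteq> 0"
    using f by auto
  then obtain m where m: "m \<noteq> 0" "poly (map_poly of_int m) z = 0"
    and least: "\<And>h. h \<noteq> 0 \<Longrightarrow> poly (map_poly of_int h) z = 0 \<Longrightarrow> degree m \<le> degree h"
    using ex_has_least_nat[of "\<lambda>h. h \<noteq> 0 \<and> poly (map_poly of_int h) z = 0" f degree] f by blast
  have dvd: "\<exists>c. c \<noteq> 0 \<and> m dvd smult c h" if h: "poly (map_poly of_int h) z = 0" for h
  proof -
    obtain c q where c: "c \<noteq> 0" "smult c h = m * q + pseudo_mod h m"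
      using pseudo_mod(1)[OF m(1), of h] by blast
    have "poly (map_poly of_int (smult c h)) z = 0"
      by (simp add: map_poly_of_int_smult h)
    then have "poly (map_poly of_int (pseudo_mod h m)) z = 0"
      unfolding c by (simp add: map_poly_of_int_add map_poly_of_int_mult m)
    then have "pseudo_mod h m = 0"
      using pseudo_mod(2)[OF m(1), of h] least[of "pseudo_mod h m"] by force
    then show ?thesis
      using c by auto
  qed
  have "degree m \<noteq> 0"
  proof
    assume "degree m = 0"
    then obtain c where "m = [:c:]"
      by (rule degree_eq_zeroE)
    then show False
      using m by (simp add: map_poly_pCons)
  qed
  obtain c s where c: "c \<noteq> 0" "smult c f = m * s"
    using dvd[OF f(3)] by (elim exE conjE dvdE)
  have "f dvd m * s"
    by (simp add: c(2)[symmetric] dvd_smult)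
  \<comment> \<open>Otherwise the nonconstant \<open>m\<close> would divide the nonzero constant
    \<open>c\<close>.\<close>
  moreover have "\<not> f dvd s"
  proof
    assume "f dvd s"
    then obtain t where "s = f * t"
      by (elim dvdE)
    with c(2) have "f * [:c:] = f * (m * t)"
      by (simp add: ac_simps)
    then have "[:c:] = m * t"
      using \<open>f \<noteq> 0\<close> by (simp only: mult_cancel_left) simp
    moreover from this have "t \<noteq> 0"
      using c(1) by auto
    ultimately have "degree [:c:] = degree m + degree t"
      using m(1) degree_mult_eq[of m t] by simp
    then show False
      using \<open>degree m \<noteq> 0\<close> by simp
  qed
  ultimately have "f dvd m"
    using f(1) by (simp add: prime_elem_dvd_mult_iff)
  obtain d where d: "d \<noteq> 0" "m dvd smult d g"
    using dvd[OF g] by blast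
  have "f dvd [:d:] * g"
    using dvd_trans[OF \<open>f dvd m\<close> d(2)] by simp
  moreover have "\<not> f dvd [:d:]"
    using f(2) d(1) by (auto dest: dvd_imp_degree_le)
  ultimately show ?thesis
    using f(1) prime_elem_dvd_multD by blast
qed

lemma zeta_power_p: "p > 0 \<Longrightarrow> zeta p ^ p = 1"
  by (simp add: zeta_def DeMoivre)

lemma zeta_nonzero: "zeta p \<noteq> 0"
  by (simp add: zeta_def)

lemma zeta_neq_1:
  assumes "p > 1"
  shows "zeta p \<noteq> 1"
proof
  assume "zeta p = 1"
  then have "cos (2 * pi / p) = 1"
    by (simp add: zeta_def complex_eq_iff)
  then obtain n :: int where "2 * pi / p = n * (2 * pi)"
    by (auto simp: cos_one_2pi_int)
  then have "real_of_int (n * int p) = real_of_int 1"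
    using assms by (simp add: field_simps)
  then have "n * int p = 1"
    by (simp only: of_int_eq_iff)
  then show False
    using assms by (auto simp: zmult_eq_1_iff)
qed

lemma prime_cyclotomic_dvd_of_zeta_root:
  assumes p: "prime p" and f: "poly (map_poly of_int f) (zeta p) = 0"
  shows "prime_cyclotomic p dvd f"
proof (rule prime_elem_dvd_of_common_root)
  have p1: "p > 1"
    using p prime_gt_1_nat by blast
  have coeff: "coeff (prime_cyclotomic p) i = (if i < p then 1 else 0)" for i
    by (simp add: prime_cyclotomic_def coeff_sum)
  show "prime_elem (prime_cyclotomic p)"
    using irreducible_prime_cyclotomic[OF p] by (rule irreducible_imp_prime_elem)
  show "degree (prime_cyclotomic p) > 0"
    using le_degree[of "prime_cyclotomic p" 1] p1 by (simp add: coeff)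
  have "map_poly of_int (prime_cyclotomic p) = (\<Sum>i<p. monom 1 i :: complex poly)"
    by (rule poly_eqI) (simp add: coeff_map_poly coeff coeff_sum)
  then have "poly (map_poly of_int (prime_cyclotomic p)) (zeta p) = (\<Sum>i<p. zeta p ^ i)"
    by (simp add: poly_sum poly_monom)
  also have "\<dots> = 0"
    using zeta_neq_1[OF p1] p1 by (simp add: geometric_sum zeta_power_p)
  finally show "poly (map_poly of_int (prime_cyclotomic p)) (zeta p) = 0" .
qed (rule f)

section \<open>Power sums over finite fields\<close>

text \<open>Translation by 1 permutes the field, so the sum of all elements equals itself plus their
  number.\<close>

lemma of_nat_card_eq_0: "of_nat (card (UNIV :: 'a set)) = (0 :: 'a::{field,finite})"
proof -
  have "(\<Sum>x\<in>UNIV. x + 1 :: 'a) = (\<Sum>x\<in>UNIV. x)"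
    by (rule sum.reindex_bij_betw) (auto intro!: bij_betwI[where g = "\<lambda>x. x - 1"])
  then show ?thesis
    by (simp add: sum.distrib)
qed

lemma CHAR_eq_of_card:
  assumes "prime p" "card (UNIV :: 'a::{field,finite} set) = p ^ m"
  shows "CHAR('a) = p"
proof -
  have "of_nat (p ^ m) = (0 :: 'a)"
    using of_nat_card_eq_0[where ?'a = 'a] by (simp only: assms(2))
  then have "CHAR('a) dvd p ^ m"
    by (simp only: of_nat_eq_0_iff_char_dvd)
  moreover have "prime CHAR('a)"
    by (rule prime_CHAR_semidom) (simp add: finite_imp_CHAR_pos)
  ultimately show ?thesis
    using assms(1) prime_dvd_power primes_dvd_imp_eq by blast
qed

text \<open>Some \<open>g\<close> in \<open>G\<close> has \<open>g ^ n \<noteq> 1\<close>, as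
  \<open>X ^ n - 1\<close> has too few roots; multiplication by \<open>g\<close> permutes
  \<open>G\<close> and scales the sum by \<open>g ^ n\<close>. General \<open>G\<close> serves both
  the field and its prime subfield.\<close>

lemma sum_power_eq_0:
  fixes G :: "'a::field set"
  assumes G: "finite G" "0 \<notin> G" "\<And>g x. g \<in> G \<Longrightarrow> x \<in> G \<Longrightarrow> g * x \<in> G"
    and n: "n > 0" "n < card G"
  shows "(\<Sum>x\<in>G. x ^ n) = 0"
proof -
  obtain g where g: "g \<in> G" "g ^ n \<noteq> 1"
  proof (rule ccontr)
    assume "\<not> thesis"
    then have "G \<subseteq> {x. poly (monom 1 n - 1) x = 0}"
      using that by (auto simp: poly_monom)
    moreover have nz: "monom 1 n - 1 \<noteq> (0 :: 'a poly)"
      using n(1) by (auto simp: poly_eq_iff intro!: exI[of _ n])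
    ultimately have "card G \<le> card {x. poly (monom 1 n - 1 :: 'a poly) x = 0}"
      by (intro card_mono poly_roots_finite)
    also have "\<dots> \<le> degree (monom 1 n - 1 :: 'a poly)"
      by (rule card_poly_roots_bound[OF nz])
    also have "\<dots> \<le> n"
      by (rule degree_diff_le) (auto simp: degree_monom_le)
    finally show False
      using n(2) by simp
  qed
  have "bij_betw ((*) g) G G"
    using G g(1) unfolding bij_betw_def
    by (intro conjI endo_inj_surj) (auto simp: inj_on_def)
  then have "(\<Sum>x\<in>G. x ^ n) = (\<Sum>x\<in>G. (g * x) ^ n)"
    by (rule sum.reindex_bij_betw[symmetric])
  also have "\<dots> = g ^ n * (\<Sum>x\<in>G. x ^ n)"
    by (simp add: power_mult_distrib sum_distrib_left)
  finally show ?thesis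
    using g(2) by simp
qed

text \<open>Negative exponents become positive under \<open>inverse\<close>; for
  \<open>N = 0\<close> the sum counts the units, one fewer than the field, whose cardinality is 0 in
  it.\<close>

lemma sum_power_int_units:
  assumes "\<bar>N\<bar> < int (card (UNIV :: 'a::{field,finite} set)) - 1"
  shows "(\<Sum>x\<in>UNIV - {0}. x powi N :: 'a) = (if N = 0 then - 1 else 0)"
proof -
  have pos: "(\<Sum>x\<in>UNIV - {0}. x ^ n :: 'a) = 0" if "n > 0" "int n < int (card (UNIV :: 'a set)) - 1" for n
    using that by (intro sum_power_eq_0) auto
  consider "N = 0" | "N > 0" | "N < 0"
    by linarith
  then show ?thesis
  proof cases
    case 1
    have "card (UNIV :: 'a set) = Suc (card (UNIV - {0} :: 'a set))"
      by (simp add: card_Diff_subset finite_UNIV_card_ge_0)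
    then have "1 + of_nat (card (UNIV - {0} :: 'a set)) = (0 :: 'a)"
      using of_nat_card_eq_0[where ?'a = 'a] by (simp only: of_nat_Suc)
    then show ?thesis
      using 1 by (simp add: eq_neg_iff_add_eq_0 add.commute)
  next
    case 2
    then show ?thesis
      using assms pos[of "nat N"] by (simp add: power_int_def)
  next
    case 3
    have "(\<Sum>x\<in>UNIV - {0}. x powi N :: 'a) = (\<Sum>x\<in>UNIV - {0}. inverse x ^ nat (- N))"
      using 3 by (intro sum.cong) (auto simp: power_int_def)
    also have "\<dots> = (\<Sum>x\<in>UNIV - {0}. x ^ nat (- N))"
      by (rule sum.reindex_bij_betw) (auto intro!: bij_betwI[where g = inverse])
    finally show ?thesis
      using 3 assms pos[of "nat (- N)"] by simp
  qed
qed

lemma inj_on_of_nat_CHAR: "inj_on (of_nat :: nat \<Rightarrow> 'a::ring_1) {..<CHAR('a)}"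
proof (rule inj_onI)
  fix i j assume "i \<in> {..<CHAR('a)}" "j \<in> {..<CHAR('a)}" "of_nat i = (of_nat j :: 'a)"
  then show "i = j"
    by (simp add: of_nat_eq_iff_cong_CHAR cong_def)
qed

text \<open>For \<open>j = 0\<close> and \<open>k > 0\<close> this is a sum over the nonzero
  residues; raising \<open>j\<close> by 1 trades the term \<open>j ^ k\<close> for
  \<open>(j + p) ^ k\<close>, the same element.\<close>

lemma sum_shifted_powers_CHAR:
  assumes p: "prime p" "CHAR('a::field) = p" and k: "k < p - 1"
  shows "(\<Sum>i<p. of_nat (i + j) ^ k :: 'a) = 0"
proof (induction j)
  case 0
  show ?case
  proof (cases "k = 0")
    case True
    then show ?thesis
      using p by auto
  next
    case False
    let ?G = "of_nat ` {1..<p} :: 'a set"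
    have inj: "inj_on (of_nat :: nat \<Rightarrow> 'a) {..<p}"
      using inj_on_of_nat_CHAR[where ?'a = 'a] p by simp
    have "(\<Sum>x\<in>?G. x ^ k) = 0"
    proof (rule sum_power_eq_0)
      have "of_nat i \<noteq> (0 :: 'a)" if "i \<in> {1..<p}" for i
        using p(2) that by (auto simp: of_nat_eq_0_iff_char_dvd dest: dvd_imp_le)
      then show "0 \<notin> ?G"
        by force
      have "card ?G = card {1..<p}"
        by (rule card_image) (rule inj_on_subset[OF inj], auto)
      then show "k < card ?G"
        using k by simp
      fix g x assume "g \<in> ?G" "x \<in> ?G"
      then obtain i j where ij: "g = of_nat i" "x = of_nat j" "i \<in> {1..<p}" "j \<in> {1..<p}"
        by auto
      then have "\<not> p dvd i * j"
        using p(1) by (auto simp: prime_dvd_mult_iff dest: dvd_imp_le)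
      then have "i * j mod p \<in> {1..<p}"
        using p(1) prime_gt_0_nat by (auto simp: Suc_le_eq dvd_eq_mod_eq_0)
      moreover have "g * x = of_nat (i * j mod p)"
        using p(2) by (simp add: ij of_nat_eq_iff_cong_CHAR cong_def flip: of_nat_mult)
      ultimately show "g * x \<in> ?G"
        by blast
    qed (use False in auto)
    then have "(\<Sum>i=1..<p. of_nat i ^ k :: 'a) = 0"
      by (subst (asm) sum.reindex) (auto intro: inj_on_subset[OF inj])
    moreover have "{..<p} = insert 0 {1..<p}"
      using p(1) prime_gt_0_nat by auto
    ultimately show ?thesis
      using False by simp
  qed
next
  case (Suc j)
  have "(\<Sum>i<p. of_nat (i + Suc j) ^ k :: 'a) + of_nat j ^ k = (\<Sum>i<Suc p. of_nat (i + j) ^ k)"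
    by (subst sum.lessThan_Suc_shift) simp
  also have "\<dots> = of_nat j ^ k"
    using Suc p(2) by (auto simp: of_nat_eq_0_iff_char_dvd)
  finally show ?case
    by simp
qed

section \<open>Moments of integer polynomials\<close>

text \<open>The value at 1 of \<open>(X d/dX) ^ k f\<close>, read in \<open>'a\<close>; at
  \<open>k = 0\<close> the constant coefficient counts too, since \<open>0 ^ 0 = 1\<close>.\<close>

definition moment :: "nat \<Rightarrow> int poly \<Rightarrow> 'a::comm_ring_1" where
  "moment k f = (\<Sum>i\<le>degree f. of_int (coeff f i) * of_nat i ^ k)"

lemma moment_eq:
  assumes "degree f \<le> n"
  shows "moment k f = (\<Sum>i\<le>n. of_int (coeff f i) * of_nat i ^ k)"
  unfolding moment_def using assms by (intro sum.mono_neutral_left) (auto simp: coeff_eq_0)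

lemma moment_add: "moment k (f + g) = moment k f + moment k g"
proof -
  let ?n = "max (degree f) (degree g)"
  show ?thesis
    by (simp add: moment_eq[of _ ?n] degree_add_le algebra_simps sum.distrib)
qed

lemma moment_diff: "moment k (f - g) = (moment k f - moment k g :: 'a::comm_ring_1)"
  using moment_add[of k "f - g" g, where ?'a = 'a] by simp

lemma moment_sum: "moment k (\<Sum>i\<in>A. f i) = (\<Sum>i\<in>A. moment k (f i))"
  by (induction A rule: infinite_finite_induct) (simp_all add: moment_add, simp_all add: moment_def)

lemma moment_monom: "moment k (monom c n) = of_int c * of_nat n ^ k"
  by (simp add: moment_eq[OF degree_monom_le] if_distrib if_distribR cong: if_cong)

text \<open>Moments are additive, and each \<open>X ^ j\<close> times the cyclotomic polynomial has
  vanishing moment by the shifted power sums.\<close>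

lemma moment_eq_0_of_zeta_root:
  assumes p: "prime p" "CHAR('a::field) = p" and k: "k < p - 1"
    and f: "poly (map_poly of_int f) (zeta p) = 0"
  shows "moment k f = (0 :: 'a)"
proof -
  obtain g where g: "f = prime_cyclotomic p * g"
    using prime_cyclotomic_dvd_of_zeta_root[OF p(1) f] by (elim dvdE)
  have "f = (\<Sum>j\<le>degree g. monom (coeff g j) j) * prime_cyclotomic p"
    by (simp add: g poly_as_sum_of_monoms mult.commute)
  also have "\<dots> = (\<Sum>j\<le>degree g. \<Sum>i<p. monom (coeff g j) (i + j))"
    by (simp add: prime_cyclotomic_def sum_product mult_monom add.commute)
  finally have "moment k f = (\<Sum>j\<le>degree g. of_int (coeff g j) * (\<Sum>i<p. of_nat (i + j) ^ k :: 'a))"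
    by (simp only: moment_sum moment_monom sum_distrib_left)
  then show ?thesis
    by (simp only: sum_shifted_powers_CHAR[OF p k]) simp
qed

section \<open>Trace values in the prime field\<close>

text \<open>The images of the numbers below \<open>p\<close> are \<open>p\<close> distinct roots of
  \<open>X ^ p - X\<close>, hence all of them; so \<open>LEAST\<close> has a candidate to
  pick.\<close>

lemma fp_rep:
  fixes x :: "'a::field"
  assumes p: "prime p" "CHAR('a) = p" and x: "x ^ p = x"
  shows "fp_rep p x < p" "of_nat (fp_rep p x) = x"
proof -
  let ?f = "monom 1 p - monom 1 1 :: 'a poly"
  have p1: "p > 1"
    using p(1) prime_gt_1_nat by blast
  have nz: "?f \<noteq> 0"
    using p1 by (auto simp: poly_eq_iff intro!: exI[of _ p])
  have "of_nat ` {..<p} = {x. poly ?f x = 0}"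
  proof (rule card_seteq)
    show "finite {x. poly ?f x = 0}"
      by (rule poly_roots_finite[OF nz])
    have "of_nat i ^ p = (of_nat i :: 'a)" for i
    proof (induction i)
      case (Suc i)
      have "(1 + of_nat i :: 'a) ^ p = 1 ^ p + of_nat i ^ p"
        by (rule freshmans_dream) (use p in simp_all)
      then show ?case
        using Suc by simp
    qed (use p1 in simp)
    then show "of_nat ` {..<p} \<subseteq> {x. poly ?f x = 0}"
      by (auto simp: poly_monom)
    have "card {x. poly ?f x = 0} \<le> degree ?f"
      by (rule card_poly_roots_bound[OF nz])
    also have "\<dots> \<le> p"
      using p1 by (intro degree_diff_le) (auto intro: order_trans[OF degree_monom_le])
    also have "p = card (of_nat ` {..<p} :: 'a set)"
      using inj_on_of_nat_CHAR[where ?'a = 'a] p(2) by (simp add: card_image)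
    finally show "card {x. poly ?f x = 0} \<le> card (of_nat ` {..<p} :: 'a set)" .
  qed
  moreover have "x \<in> {x. poly ?f x = 0}"
    using x by (simp add: poly_monom)
  ultimately have "x \<in> of_nat ` {..<p}"
    by (simp only:)
  then obtain i where "i < p" "of_nat i = x"
    by auto
  then have "fp_rep p x < p \<and> of_nat (fp_rep p x) = x"
    unfolding fp_rep_def by (intro LeastI[of "\<lambda>k. k < p \<and> of_nat k = x" i]) simp
  then show "fp_rep p x < p" "of_nat (fp_rep p x) = x"
    by simp_all
qed

lemma power_card_eq_same:
  fixes x :: "'a::{field,finite}"
  shows "x ^ card (UNIV :: 'a set) = x"
proof (cases "x = 0")
  case False
  let ?U = "UNIV - {0} :: 'a set"
  have "bij_betw ((*) x) ?U ?U"
    using False by (intro bij_betwI[where g = "\<lambda>y. y / x"]) auto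
  then have "(\<Prod>y\<in>?U. x * y) = (\<Prod>y\<in>?U. y)"
    by (rule prod.reindex_bij_betw)
  then have "x ^ card ?U = 1"
    by (simp add: prod.distrib)
  then have "x * x ^ card ?U = x"
    by simp
  moreover have "card (UNIV :: 'a set) = Suc (card ?U)"
    by (simp add: card_Diff_subset finite_UNIV_card_ge_0)
  ultimately show ?thesis
    by (simp only: power_Suc)
qed (simp add: finite_UNIV_card_ge_0)

text \<open>Frobenius shifts the summands cyclically; hence trace values have representatives below
  \<open>p\<close>.\<close>

lemma trace_power_p:
  fixes x :: "'a::{field,finite}"
  assumes p: "prime p" and card: "card (UNIV :: 'a set) = p ^ m"
  shows "trace p m x ^ p = trace p m x"
proof -
  have char: "CHAR('a) = p"
    using CHAR_eq_of_card[OF p card] .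
  have "x ^ (p ^ m) = x"
    using power_card_eq_same[of x] card by simp
  have "trace p m x ^ p = (\<Sum>k<m. x ^ (p ^ Suc k))"
    unfolding trace_def using p char
    by (subst freshmans_dream_sum) (simp_all flip: power_mult add: mult.commute)
  also have "\<dots> + x = (\<Sum>k<Suc m. x ^ (p ^ k))"
    by (subst sum.lessThan_Suc_shift) simp
  also have "\<dots> = trace p m x + x"
    using \<open>x ^ (p ^ m) = x\<close> by (simp add: trace_def)
  finally show ?thesis
    by simp
qed

lemma map_poly_of_int_diff:
  "map_poly of_int (f - g) = (map_poly of_int f - map_poly of_int g :: 'a::ring_1 poly)"
  by (rule poly_eqI) (simp add: coeff_map_poly)

lemma map_poly_of_int_sum:
  "map_poly of_int (\<Sum>i\<in>A. f i) = (\<Sum>i\<in>A. map_poly of_int (f i) :: 'a::ring_1 poly)"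
  by (rule poly_eqI) (simp add: coeff_map_poly coeff_sum)

lemma map_poly_of_int_monom:
  "map_poly of_int (monom c n) = (monom (of_int c) n :: 'a::ring_1 poly)"
  by (rule poly_eqI) (simp add: coeff_map_poly)

section \<open>Moments of the Kloosterman sum\<close>

text \<open>Multiplying the Kloosterman sum by \<open>zeta p + inverse (zeta p)\<close> shifts every
  exponent by 1 and by -1, whence the two powers on the left.\<close>

lemma kloosterman_moment_relation:
  fixes a :: "'a::{field,finite}" and p m :: nat
  defines "T \<equiv> (\<lambda>x. trace p m (x ^ (card (UNIV :: 'a set) - 2) + a * x))"
  assumes p: "prime p" and card: "card (UNIV :: 'a set) = p ^ m"
    and nz: "zeta p + inverse (zeta p) \<noteq> 0"
    and K: "kloosterman p m a = 1 - 2 / (zeta p + inverse (zeta p))"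
    and k: "k < p - 1"
  shows "(\<Sum>x\<in>UNIV. (T x + 1) ^ k + (T x - 1) ^ k) = 1 + (- 1) ^ k - 2 * 0 ^ k"
proof -
  let ?z = "zeta p"
  define r where "r x = fp_rep p (T x)" for x
  have char: "CHAR('a) = p"
    using CHAR_eq_of_card[OF p card] .
  have p0: "p > 0"
    using p prime_gt_0_nat by blast
  have r: "of_nat (r x) = T x" for x
    unfolding r_def T_def by (rule fp_rep(2)[OF p char trace_power_p[OF p card]])
  have of_nat_pred: "of_nat (n + (p - 1)) = (of_nat n - 1 :: 'a)" for n
  proof -
    have "of_nat (n + (p - 1)) + 1 = (of_nat (n + (p - 1) + 1) :: 'a)"
      by (simp only: of_nat_add of_nat_1)
    also have "n + (p - 1) + 1 = n + p"
      using p0 by simp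
    also have "of_nat (n + p) = (of_nat n + of_nat p :: 'a)"
      by simp
    also have "\<dots> = of_nat n"
      using of_nat_CHAR[where ?'a = 'a] char by simp
    finally show ?thesis
      by (simp only: eq_diff_eq)
  qed
  have zeta_pred: "?z ^ (n + (p - 1)) = ?z ^ n * inverse ?z" for n
  proof -
    have "?z ^ (p - 1) * ?z = 1"
      using p0 zeta_power_p[of p] by (simp flip: power_Suc2)
    then have "?z ^ (p - 1) = inverse ?z"
      by (simp add: field_simps zeta_nonzero)
    then show ?thesis
      by (simp add: power_add)
  qed
  \<comment> \<open>The exponent \<open>p - 1\<close> stands for -1; in \<open>0 + (p - 1)\<close>
    the zero lets \<open>zeta_pred\<close> and \<open>of_nat_pred\<close> apply.\<close>
  define Q where "Q = (\<Sum>x\<in>UNIV. monom 1 (r x + 1) + monom 1 (r x + (p - 1)))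
    - (monom 1 1 + monom 1 (0 + (p - 1))) + monom (2 :: int) 0"
  have "poly (map_poly of_int Q) ?z = (\<Sum>x\<in>UNIV. ?z ^ (r x + 1) + ?z ^ (r x + (p - 1)))
      - (?z ^ 1 + ?z ^ (0 + (p - 1))) + 2"
    by (simp add: Q_def map_poly_of_int_add map_poly_of_int_diff map_poly_of_int_sum
        map_poly_of_int_monom poly_sum poly_monom)
  also have "\<dots> = (?z + inverse ?z) * (\<Sum>x\<in>UNIV. ?z ^ r x) - (?z + inverse ?z) + 2"
    by (simp only: zeta_pred) (simp add: algebra_simps sum.distrib sum_distrib_left)
  also have "(\<Sum>x\<in>UNIV. ?z ^ r x) = kloosterman p m a"
    by (simp add: kloosterman_def r_def T_def)
  also have "(?z + inverse ?z) * kloosterman p m a - (?z + inverse ?z) + 2 = 0"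
    unfolding K using nz by (simp add: field_simps)
  finally have "moment k Q = (0 :: 'a)"
    by (rule moment_eq_0_of_zeta_root[OF p char k])
  moreover have "moment k Q = (\<Sum>x\<in>UNIV. (T x + 1) ^ k + (T x - 1) ^ k) - (1 + (- 1) ^ k) + 2 * 0 ^ k"
    unfolding Q_def moment_add moment_diff moment_sum moment_monom of_nat_pred
    by (simp add: r add.commute)
  ultimately show ?thesis
    by (simp add: algebra_simps eq_neg_iff_add_eq_0)
qed

text \<open>For even \<open>k\<close> the odd powers cancel in
  \<open>(t + 1) ^ k + (t - 1) ^ k\<close>, so the relations form a triangular system, solved in
  turn.\<close>

lemma kloosterman_moments:
  fixes a :: "'a::{field,finite}" and p m :: nat
  defines "M \<equiv> (\<lambda>k. \<Sum>x\<in>UNIV. trace p m (x ^ (card (UNIV :: 'a set) - 2) + a * x) ^ k)"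
  assumes p: "prime p" "p > 9" and card: "card (UNIV :: 'a set) = p ^ m"
    and K: "kloosterman p m a = 1 - 2 / (zeta p + inverse (zeta p))"
  shows "M 2 = 1" "M 4 = - 5" "M 6 = 61" "M 8 = - 1385"
proof -
  let ?T = "\<lambda>x. trace p m (x ^ (card (UNIV :: 'a set) - 2) + a * x)"
  have char: "CHAR('a) = p"
    using CHAR_eq_of_card[OF p(1) card] .
  \<comment> \<open>\<open>zeta p + inverse (zeta p)\<close> is twice this cosine, so the division
    in the hypothesis is a genuine one.\<close>
  have "cos (2 * pi / p) > 0"
  proof (rule cos_gt_zero_pi)
    have "2 * pi / p < pi / 2"
      using p(2) by (simp add: field_simps)
    then show "2 * pi / p < pi / 2" .
    have "2 * pi / p \<ge> 0"
      by simp
    then show "- (pi / 2) < 2 * pi / p"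
      using pi_gt_zero by linarith
  qed
  then have "Re (zeta p + inverse (zeta p)) \<noteq> 0"
    by (simp add: zeta_def)
  then have nz: "zeta p + inverse (zeta p) \<noteq> 0"
    by (metis zero_complex.sel(1))
  have two: "(2 :: 'a) \<noteq> 0"
    using of_nat_eq_0_iff_char_dvd[of 2, where ?'a = 'a] char p(2) by (auto dest: dvd_imp_le)
  have rel: "(\<Sum>x\<in>UNIV. (?T x + 1) ^ k + (?T x - 1) ^ k) = 1 + (- 1) ^ k - 2 * 0 ^ k" if "k \<le> 8" for k
    using kloosterman_moment_relation[OF p(1) card nz K, of k] that p(2) by simp
  have expand: "(t + 1) ^ 2 + (t - 1) ^ 2 = 2 * (t ^ 2 + 1)"
    "(t + 1) ^ 4 + (t - 1) ^ 4 = 2 * (t ^ 4 + 6 * t ^ 2 + 1)"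
    "(t + 1) ^ 6 + (t - 1) ^ 6 = 2 * (t ^ 6 + 15 * t ^ 4 + 15 * t ^ 2 + 1)"
    "(t + 1) ^ 8 + (t - 1) ^ 8 = 2 * (t ^ 8 + 28 * t ^ 6 + 70 * t ^ 4 + 28 * t ^ 2 + 1)" for t :: 'a
    by algebra+
  \<comment> \<open>The constant term 1 of each halved expansion, summed over the field, contributes
    0.\<close>
  note card0 = of_nat_card_eq_0[where ?'a = 'a]
  have sum2: "(\<Sum>x\<in>UNIV. 2 * f x) = 2 * (\<Sum>x\<in>UNIV. f x)" for f :: "'a \<Rightarrow> 'a"
    by (simp add: sum_distrib_left)
  have cancel: "(\<Sum>x\<in>UNIV. f x) = 1" if "(\<Sum>x\<in>UNIV. 2 * f x) = 2" for f :: "'a \<Rightarrow> 'a"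
  proof -
    have "2 * (\<Sum>x\<in>UNIV. f x) = 2 * 1"
      using that by (simp add: sum2)
    then show ?thesis
      using two by (simp only: mult_cancel_left) simp
  qed
  have "M 2 = 1"
    using cancel[of "\<lambda>x. ?T x ^ 2 + 1"] rel[of 2] card0
    by (simp add: M_def expand sum.distrib)
  moreover have "M 4 + 6 * M 2 = 1"
    using cancel[of "\<lambda>x. ?T x ^ 4 + 6 * ?T x ^ 2 + 1"] rel[of 4] card0
    by (simp add: M_def expand sum.distrib flip: sum_distrib_left)
  moreover have "M 6 + 15 * M 4 + 15 * M 2 = 1"
    using cancel[of "\<lambda>x. ?T x ^ 6 + 15 * ?T x ^ 4 + 15 * ?T x ^ 2 + 1"] rel[of 6] card0
    by (simp add: M_def expand sum.distrib flip: sum_distrib_left)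
  moreover have "M 8 + 28 * M 6 + 70 * M 4 + 28 * M 2 = 1"
    using cancel[of "\<lambda>x. ?T x ^ 8 + 28 * ?T x ^ 6 + 70 * ?T x ^ 4 + 28 * ?T x ^ 2 + 1"] rel[of 8] card0
    by (simp add: M_def expand sum.distrib flip: sum_distrib_left)
  ultimately show "M 2 = 1" "M 4 = - 5" "M 6 = 61" "M 8 = - 1385"
    by algebra+
qed

section \<open>Moments as constant terms\<close>

text \<open>
  \<open>const_term b n k\<close> is the constant term of \<open>(\<Sum>i<n. b\<^sub>i X\<^sub>i + 1/X\<^sub>i)\<^sup>k\<close> for independent
  \<open>X\<^sub>i\<close>; in the recursion \<open>j\<close> is the number of factors contributing a term in \<open>X\<^sub>n\<close> and \<open>s\<close> of
  them contribute \<open>b\<^sub>n X\<^sub>n\<close>.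
\<close>

fun const_term :: "(nat \<Rightarrow> 'a::comm_ring_1) \<Rightarrow> nat \<Rightarrow> nat \<Rightarrow> 'a" where
  "const_term b 0 k = (if k = 0 then 1 else 0)"
| "const_term b (Suc n) k = (\<Sum>j\<le>k. \<Sum>s\<le>j. if 2 * s = j then
     of_nat ((k choose j) * (j choose s)) * b n ^ s * const_term b n (k - j) else 0)"

text \<open>
  The factor \<open>x powi N\<close> accounts for the terms already chosen at the positions \<open>\<ge> n\<close>. The bound on
  \<open>N\<close> keeps all exponents below \<open>q - 1\<close> in absolute value, and \<open>p\<^sup>n dvd N\<close> together with digits of
  absolute value less than \<open>p / 2\<close> rules out cancellation between different positions.
\<close>

lemma sum_power_int_const_term:
  fixes b :: "nat \<Rightarrow> 'a::{field,finite}" and N :: int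
  assumes card: "card (UNIV :: 'a set) = q" and k: "2 * k < p"
    and N: "int p ^ n dvd N" "2 * \<bar>N\<bar> + int p ^ n \<le> int q"
  shows "(\<Sum>x\<in>UNIV - {0}. x powi N * (\<Sum>i<n. b i * x ^ (p ^ i) + inverse x ^ (p ^ i)) ^ k)
    = (if N = 0 then - const_term b n k else 0)"
  using k N
proof (induction n arbitrary: k N)
  case 0
  \<comment> \<open>\<open>q \<ge> 2\<close> is needed for the strict bound when
    \<open>N = 0\<close>.\<close>
  have "card {0, 1 :: 'a} \<le> card (UNIV :: 'a set)"
    by (intro card_mono) auto
  then have "\<bar>N\<bar> < int q - 1"
    using 0 by (simp add: card)
  then show ?case
    by (cases "k = 0") (simp_all add: sum_power_int_units card power_0_left)
next
  case (Suc n)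
  define P where "P = p ^ n"
  define R where "R x = (\<Sum>i<n. b i * x ^ (p ^ i) + inverse x ^ (p ^ i))" for x
  have expand: "x powi N * (R x + (b n * x ^ P + inverse x ^ P)) ^ k =
      (\<Sum>j\<le>k. \<Sum>s\<le>j. of_nat ((k choose j) * (j choose s)) * b n ^ s *
        (x powi (N + int P * (2 * int s - int j)) * R x ^ (k - j)))" if "x \<noteq> 0" for x
  proof -
    have "(b n * x ^ P + inverse x ^ P) ^ j =
        (\<Sum>s\<le>j. of_nat (j choose s) * b n ^ s * x powi (int P * (2 * int s - int j)))" for j
    proof -
      have "(b n * x ^ P) ^ s * (inverse x ^ P) ^ (j - s) = b n ^ s * x powi (int P * (2 * int s - int j))"
        if "s \<le> j" for s
      proof -
        have "(x ^ P) ^ s * (inverse x ^ P) ^ (j - s) = x powi (int (P * s)) * x powi (- int (P * (j - s)))"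
          by (simp only: power_int_minus power_int_of_nat) (simp add: power_inverse flip: power_mult)
        also have "\<dots> = x powi (int (P * s) + - int (P * (j - s)))"
          using \<open>x \<noteq> 0\<close> by (subst power_int_add) simp_all
        also have "int (P * s) + - int (P * (j - s)) = int P * (2 * int s - int j)"
          using that by (simp add: of_nat_diff algebra_simps)
        finally show ?thesis
          by (simp add: power_mult_distrib mult.assoc)
      qed
      then show ?thesis
        by (subst binomial_ring) (auto intro!: sum.cong simp: mult.assoc)
    qed
    then show ?thesis
      using that
      by (subst add.commute, subst binomial_ring)
        (simp add: sum_distrib_left sum_distrib_right power_int_add mult_ac)
  qed
  have IH: "(\<Sum>x\<in>UNIV - {0}. x powi (N + int P * (2 * int s - int j)) * R x ^ (k - j))
      = (if N = 0 \<and> 2 * s = j then - const_term b n (k - j) else 0)" if js: "j \<le> k" "s \<le> j" for j s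
  proof -
    let ?d = "2 * int s - int j"
    have d: "\<bar>?d\<bar> \<le> int k"
      using js by linarith
    have "2 * \<bar>N + int P * ?d\<bar> + int P \<le> 2 * \<bar>N\<bar> + int P * (2 * \<bar>?d\<bar> + 1)"
    proof -
      have "\<bar>int P * ?d\<bar> = int P * \<bar>?d\<bar>"
        by (simp add: abs_mult)
      moreover have "int P * (2 * \<bar>?d\<bar> + 1) = 2 * (int P * \<bar>?d\<bar>) + int P"
        by (simp only: distrib_left mult_1_right mult.left_commute)
      ultimately show ?thesis
        using abs_triangle_ineq[of N "int P * ?d"] by linarith
    qed
    \<comment> \<open>From \<open>2 * k < p\<close> follows
      \<open>2 * \<bar>?d\<bar> + 1 \<le> p\<close>: the slack at \<open>Suc n\<close> pays for one
      digit and the slack at \<open>n\<close>.\<close>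
    also have "int P * (2 * \<bar>?d\<bar> + 1) \<le> int P * int p"
      using d Suc.prems(1) by (intro mult_left_mono) auto
    finally have le: "2 * \<bar>N + int P * ?d\<bar> + int P \<le> int q"
      using Suc.prems(3) by (simp add: P_def mult.commute)
    have dvd: "int P * int p dvd N"
      using Suc.prems(2) by (simp add: P_def mult.commute)
    then have "int P dvd N + int P * ?d"
      using dvd_mult_left by auto
    \<comment> \<open>If the exponent vanishes, \<open>p\<close> divides the digit
      \<open>?d\<close>; as \<open>\<bar>?d\<bar> \<le> k < p\<close>, the digit is 0.\<close>
    moreover have "N + int P * ?d = 0 \<longleftrightarrow> N = 0 \<and> 2 * s = j"
    proof
      assume eq: "N + int P * ?d = 0"
      have P: "P > 0"
        using Suc.prems(1) by (simp add: P_def)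
      from dvd obtain c where "N = int P * int p * c"
        by (elim dvdE)
      with eq have "int P * (int p * c + ?d) = 0"
        by (simp add: algebra_simps)
      with P have c: "int p * c + ?d = 0"
        by simp
      then have "int p dvd ?d"
        by (metis dvd_add_right_iff dvd_triv_left dvd_0_right)
      then have "?d = 0"
        using d Suc.prems(1) zdvd_imp_le[of "int p" "\<bar>?d\<bar>"] by (cases "?d = 0") auto
      then show "N = 0 \<and> 2 * s = j"
        using eq by auto
    qed auto
    ultimately show ?thesis
      unfolding R_def using Suc.IH[of "k - j" "N + int P * ?d"] le Suc.prems(1) by (simp add: P_def)
  qed
  have "(\<Sum>x\<in>UNIV - {0}. x powi N * (\<Sum>i<Suc n. b i * x ^ (p ^ i) + inverse x ^ (p ^ i)) ^ k)
    = (\<Sum>x\<in>UNIV - {0}. \<Sum>j\<le>k. \<Sum>s\<le>j. of_nat ((k choose j) * (j choose s)) * b n ^ s *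
        (x powi (N + int P * (2 * int s - int j)) * R x ^ (k - j)))"
    using expand by (intro sum.cong) (simp_all add: R_def P_def)
  also have "\<dots> = (\<Sum>j\<le>k. \<Sum>s\<le>j. of_nat ((k choose j) * (j choose s)) * b n ^ s *
      (\<Sum>x\<in>UNIV - {0}. x powi (N + int P * (2 * int s - int j)) * R x ^ (k - j)))"
    by (simp only: sum.swap[of _ _ "UNIV - {0}"] sum_distrib_left)
  also have "\<dots> = (\<Sum>j\<le>k. \<Sum>s\<le>j. of_nat ((k choose j) * (j choose s)) * b n ^ s *
      (if N = 0 \<and> 2 * s = j then - const_term b n (k - j) else 0))"
    by (intro sum.cong refl) (simp add: IH)
  also have "\<dots> = (if N = 0 then - const_term b (Suc n) k else 0)"
    by (auto simp: sum_negf[symmetric] intro!: sum.cong)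
  finally show ?case .
qed

text \<open>Only even \<open>j = 2 * s\<close> contribute, so even orders form a closed recursion
  with coefficients \<open>(k choose (2 * s)) * ((2 * s) choose s)\<close>.\<close>

lemma const_term_Suc:
  "const_term b (Suc n) 0 = const_term b n 0"
  "const_term b (Suc n) 2 = const_term b n 2 + 2 * b n * const_term b n 0"
  "const_term b (Suc n) 4 = const_term b n 4 + 12 * b n * const_term b n 2 + 6 * b n ^ 2 * const_term b n 0"
  "const_term b (Suc n) 6 = const_term b n 6 + 30 * b n * const_term b n 4
    + 90 * b n ^ 2 * const_term b n 2 + 20 * b n ^ 3 * const_term b n 0"
  "const_term b (Suc n) 8 = const_term b n 8 + 56 * b n * const_term b n 6
    + 420 * b n ^ 2 * const_term b n 4 + 560 * b n ^ 3 * const_term b n 2 + 70 * b n ^ 4 * const_term b n 0"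
proof -
  have "4 choose 2 = 6" "6 choose 2 = 15" "6 choose 3 = 20" "6 choose 4 = 15"
    "8 choose 2 = 28" "8 choose 4 = 70" "8 choose 6 = 28"
    by (simp_all add: numeral_eq_Suc)
  then show "const_term b (Suc n) 0 = const_term b n 0"
    "const_term b (Suc n) 2 = const_term b n 2 + 2 * b n * const_term b n 0"
    "const_term b (Suc n) 4 = const_term b n 4 + 12 * b n * const_term b n 2 + 6 * b n ^ 2 * const_term b n 0"
    "const_term b (Suc n) 6 = const_term b n 6 + 30 * b n * const_term b n 4
      + 90 * b n ^ 2 * const_term b n 2 + 20 * b n ^ 3 * const_term b n 0"
    "const_term b (Suc n) 8 = const_term b n 8 + 56 * b n * const_term b n 6
      + 420 * b n ^ 2 * const_term b n 4 + 560 * b n ^ 3 * const_term b n 2 + 70 * b n ^ 4 * const_term b n 0"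
    by (simp_all add: atMost_nat_numeral atMost_Suc)
qed

text \<open>
  With \<open>B(w) = (\<Sum>s. w\<^sup>s / (s!)\<^sup>2)\<close>, the value \<open>const_term b n (2 k) / (2 k)!\<close> is the coefficient of
  \<open>w\<^sup>k\<close> in \<open>\<Prod>i<n. B (b\<^sub>i w)\<close>; the formulas come from expanding the exponential of
  \<open>\<Sum>i<n. ln (B (b\<^sub>i w))\<close>, where \<open>ln (B w) = w - w\<^sup>2/4 + w\<^sup>3/9 - 11 w\<^sup>4/192 + \<dots>\<close>.
\<close>

lemma const_term_power_sums:
  fixes b :: "nat \<Rightarrow> 'a::idom"
  defines "P \<equiv> \<lambda>n r. \<Sum>i<n. b i ^ r"
  shows "const_term b n 2 = 2 * P n 1"
    and "const_term b n 4 = 12 * P n 1 ^ 2 - 6 * P n 2"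
    and "const_term b n 6 = 120 * P n 1 ^ 3 - 180 * P n 1 * P n 2 + 80 * P n 3"
    and "const_term b n 8 = 1680 * P n 1 ^ 4 - 5040 * P n 1 ^ 2 * P n 2 + 1260 * P n 2 ^ 2
      + 4480 * P n 1 * P n 3 - 2310 * P n 4"
proof -
  have P: "P 0 r = 0" "P (Suc n) r = P n r + b n ^ r" for n r
    by (simp_all add: P_def)
  have 0: "const_term b n 0 = 1" for n
    by (induction n) (simp_all add: const_term_Suc del: const_term.simps(2))
  have 2: "const_term b n 2 = 2 * P n 1" for n
    by (induction n) (simp_all add: const_term_Suc 0 P algebra_simps del: const_term.simps(2))
  have 4: "const_term b n 4 = 12 * P n 1 ^ 2 - 6 * P n 2" for n
    proof (induction n)
    case (Suc n)
    then show ?case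
      unfolding const_term_Suc 0 2 P by algebra
  qed (simp add: P)
  have 6: "const_term b n 6 = 120 * P n 1 ^ 3 - 180 * P n 1 * P n 2 + 80 * P n 3" for n
    proof (induction n)
    case (Suc n)
    then show ?case
      unfolding const_term_Suc 0 2 4 P by algebra
  qed (simp add: P)
  have 8: "const_term b n 8 = 1680 * P n 1 ^ 4 - 5040 * P n 1 ^ 2 * P n 2 + 1260 * P n 2 ^ 2
      + 4480 * P n 1 * P n 3 - 2310 * P n 4" for n
    proof (induction n)
    case (Suc n)
    then show ?case
      unfolding const_term_Suc 0 2 4 6 P by algebra
  qed (simp add: P)
  show "const_term b n 2 = 2 * P n 1"
    and "const_term b n 4 = 12 * P n 1 ^ 2 - 6 * P n 2"
    and "const_term b n 6 = 120 * P n 1 ^ 3 - 180 * P n 1 * P n 2 + 80 * P n 3"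
    and "const_term b n 8 = 1680 * P n 1 ^ 4 - 5040 * P n 1 ^ 2 * P n 2 + 1260 * P n 2 ^ 2
      + 4480 * P n 1 * P n 3 - 2310 * P n 4"
    by (rule 2 4 6 8)+
qed

text \<open>With the largest index summed outermost, passing to \<open>Suc n\<close> adds
  \<open>b n\<close> times the previous elementary symmetric function; induction leaves polynomial
  identities. Factorials stay on the left as they may vanish in \<open>'a\<close>.\<close>

lemma newton_identities:
  fixes b :: "nat \<Rightarrow> 'a::idom"
  defines "P \<equiv> \<lambda>n r. \<Sum>i<n. b i ^ r"
  defines "e2 \<equiv> \<lambda>n. \<Sum>j<n. \<Sum>i<j. b i * b j"
  defines "e3 \<equiv> \<lambda>n. \<Sum>k<n. \<Sum>j<k. \<Sum>i<j. b i * b j * b k"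
  defines "e4 \<equiv> \<lambda>n. \<Sum>l<n. \<Sum>k<l. \<Sum>j<k. \<Sum>i<j. b i * b j * b k * b l"
  shows "2 * e2 n = P n 1 ^ 2 - P n 2"
    and "6 * e3 n = P n 1 ^ 3 - 3 * P n 1 * P n 2 + 2 * P n 3"
    and "24 * e4 n = P n 1 ^ 4 - 6 * P n 1 ^ 2 * P n 2 + 3 * P n 2 ^ 2 + 8 * P n 1 * P n 3 - 6 * P n 4"
proof -
  have P: "P 0 r = 0" "P (Suc n) r = P n r + b n ^ r" for n r
    by (simp_all add: P_def)
  have e: "e2 0 = 0" "e3 0 = 0" "e4 0 = 0"
    "e2 (Suc n) = e2 n + P n 1 * b n" "e3 (Suc n) = e3 n + e2 n * b n" "e4 (Suc n) = e4 n + e3 n * b n" for n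
    by (simp_all add: e2_def e3_def e4_def P_def sum_distrib_right)
  have 2: "2 * e2 n = P n 1 ^ 2 - P n 2" for n
  proof (induction n)
    case (Suc n)
    then show ?case
      unfolding e P by algebra
  qed (simp add: e P)
  have 3: "6 * e3 n = P n 1 ^ 3 - 3 * P n 1 * P n 2 + 2 * P n 3" for n
  proof (induction n)
    case (Suc n)
    then show ?case
      unfolding e P using 2[of n] by algebra
  qed (simp add: e P)
  have 4: "24 * e4 n = P n 1 ^ 4 - 6 * P n 1 ^ 2 * P n 2 + 3 * P n 2 ^ 2 + 8 * P n 1 * P n 3 - 6 * P n 4" for n
  proof (induction n)
    case (Suc n)
    then show ?case
      unfolding e P using 3[of n] by algebra
  qed (simp add: e P)
  show "2 * e2 n = P n 1 ^ 2 - P n 2"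
    and "6 * e3 n = P n 1 ^ 3 - 3 * P n 1 * P n 2 + 2 * P n 3"
    and "24 * e4 n = P n 1 ^ 4 - 6 * P n 1 ^ 2 * P n 2 + 3 * P n 2 ^ 2 + 8 * P n 1 * P n 3 - 6 * P n 4"
    by (rule 2 3 4)+
qed

section \<open>Application to the trace and solution for the power sums\<close>

text \<open>On units the power \<open>q - 2\<close> is inversion, and Frobenius is additive; the
  result has the shape treated by \<open>sum_power_int_const_term\<close>.\<close>

lemma trace_inverse_add:
  fixes a x :: "'a::{field,finite}" and p m :: nat
  assumes p: "prime p" "p ^ m > 2" and card: "card (UNIV :: 'a set) = p ^ m" and x: "x \<noteq> 0"
  shows "trace p m (x ^ (card (UNIV :: 'a set) - 2) + a * x)
    = (\<Sum>i<m. a ^ (p ^ i) * x ^ (p ^ i) + inverse x ^ (p ^ i))"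
proof -
  have char: "CHAR('a) = p"
    using CHAR_eq_of_card[OF p(1) card] .
  have "x ^ (card (UNIV :: 'a set) - 2) * x ^ 2 = x ^ card (UNIV :: 'a set)"
    using p(2) by (simp only: card power_add[symmetric] le_add_diff_inverse2 less_imp_le)
  also have "\<dots> = x"
    by (rule power_card_eq_same)
  finally have "x ^ (card (UNIV :: 'a set) - 2) = inverse x"
    using x by (simp add: field_simps power2_eq_square)
  moreover have "(inverse x + a * x) ^ (p ^ i) = inverse x ^ (p ^ i) + (a * x) ^ (p ^ i)" for i
    by (rule freshmans_dream') (use p char in simp_all)
  ultimately show ?thesis
    by (simp add: trace_def power_mult_distrib add.commute)
qed

text \<open>This is the case \<open>N = 0\<close>; the point \<open>x = 0\<close> adds nothing, as
  \<open>k\<close> and the exponent \<open>q - 2\<close> are positive.\<close>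

lemma kloosterman_moment_const_term:
  fixes a :: "'a::{field,finite}" and p m k :: nat
  assumes p: "prime p" "p > 2" and m: "m \<ge> 1" and card: "card (UNIV :: 'a set) = p ^ m"
    and k: "0 < k" "2 * k < p"
  shows "(\<Sum>x\<in>UNIV. trace p m (x ^ (card (UNIV :: 'a set) - 2) + a * x) ^ k)
    = - const_term (\<lambda>i. a ^ (p ^ i)) m k"
proof -
  let ?T = "\<lambda>x. trace p m (x ^ (card (UNIV :: 'a set) - 2) + a * x)"
  have "p ^ 1 \<le> p ^ m"
    using p m by (intro power_increasing) auto
  then have q: "p ^ m > 2"
    using p by simp
  have "trace p m (0 :: 'a) = 0"
    using p by (simp add: trace_def power_0_left)
  then have T0: "?T 0 = 0"
    using q card by (simp add: power_0_left)
  have "(\<Sum>x\<in>UNIV. ?T x ^ k) = (\<Sum>x\<in>UNIV - {0}. ?T x ^ k)"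
    using T0 k by (subst sum.remove[of UNIV 0]) simp_all
  also have "\<dots> = (\<Sum>x\<in>UNIV - {0}. x powi 0 * (\<Sum>i<m. a ^ (p ^ i) * x ^ (p ^ i) + inverse x ^ (p ^ i)) ^ k)"
    using trace_inverse_add[OF p(1) q card] by (intro sum.cong) simp_all
  also have "\<dots> = - const_term (\<lambda>i. a ^ (p ^ i)) m k"
    by (subst sum_power_int_const_term[OF card k(2)]) simp_all
  finally show ?thesis .
qed

theorem theorem5:
  fixes a :: "'a::{field,finite}" and p m :: nat
  assumes "prime p" and "p > 13" and "m \<ge> 1"
    and "card (UNIV::'a set) = p ^ m"
    and "kloosterman p m a = 1 - 2 / (zeta p + inverse (zeta p))"
  shows "trace p m a = - (1 / 2)
    \<and> trace p m (a ^ 2) = - (1 / 3)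
    \<and> trace p m (a ^ 3) = - (1 / 5)
    \<and> trace p m (a ^ 4) = - (136 / 1155)
    \<and> (\<Sum>j<m. \<Sum>i<j. a ^ (p ^ i + p ^ j)) = 7 / 24
    \<and> (\<Sum>k<m. \<Sum>j<k. \<Sum>i<j. a ^ (p ^ i + p ^ j + p ^ k)) = - (41 / 240)
    \<and> (\<Sum>l<m. \<Sum>k<l. \<Sum>j<k. \<Sum>i<j. a ^ (p ^ i + p ^ j + p ^ k + p ^ l)) = 8879 / 88704"
proof -
  let ?b = "\<lambda>i. a ^ (p ^ i)"
  define P where "P r = (\<Sum>i<m. ?b i ^ r)" for r
  define e2 where "e2 = (\<Sum>j<m. \<Sum>i<j. a ^ (p ^ i + p ^ j))"
  define e3 where "e3 = (\<Sum>k<m. \<Sum>j<k. \<Sum>i<j. a ^ (p ^ i + p ^ j + p ^ k))"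
  define e4 where "e4 = (\<Sum>l<m. \<Sum>k<l. \<Sum>j<k. \<Sum>i<j. a ^ (p ^ i + p ^ j + p ^ k + p ^ l))"
  \<comment> \<open>The eighth moment requires \<open>2 * 8 < p\<close>; 14, 15 and 16 are
    composite.\<close>
  have "p \<noteq> 14" "p \<noteq> 15" "p \<noteq> 16"
    using prime_nat_not_dvd[OF \<open>prime p\<close>, of 2] prime_nat_not_dvd[OF \<open>prime p\<close>, of 3] by auto
  then have p17: "p \<ge> 17"
    using \<open>p > 13\<close> by linarith
  have char: "CHAR('a) = p"
    using CHAR_eq_of_card[OF \<open>prime p\<close>] assms(4) .
  \<comment> \<open>a common multiple of all denominators below with prime factors up to 11\<close>
  have "of_nat n \<noteq> (0 :: 'a)" if "n dvd 443520" for n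
  proof
    assume "of_nat n = (0 :: 'a)"
    then have "p dvd 443520"
      using dvd_trans[OF _ that] char by (simp add: of_nat_eq_0_iff_char_dvd)
    also have "443520 = 2 ^ 7 * 3 ^ 2 * 5 * 7 * (11 :: nat)"
      by simp
    finally have "p dvd 2 \<or> p dvd 3 \<or> p dvd 5 \<or> p dvd 7 \<or> p dvd 11"
      using \<open>prime p\<close> by (simp only: prime_dvd_mult_iff prime_dvd_power_iff) (auto dest: prime_dvd_power)
    then show False
      using p17 by (auto dest: dvd_imp_le)
  qed
  from this[of 2] this[of 3] this[of 5] this[of 6] this[of 16] this[of 24] this[of 240] this[of 1155] this[of 88704]
  have nz: "(2 :: 'a) \<noteq> 0" "(3 :: 'a) \<noteq> 0" "(5 :: 'a) \<noteq> 0" "(6 :: 'a) \<noteq> 0" "(16 :: 'a) \<noteq> 0"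
    "(24 :: 'a) \<noteq> 0" "(240 :: 'a) \<noteq> 0" "(1155 :: 'a) \<noteq> 0" "(88704 :: 'a) \<noteq> 0"
    by simp_all
  have newton: "2 * e2 = P 1 ^ 2 - P 2" "6 * e3 = P 1 ^ 3 - 3 * P 1 * P 2 + 2 * P 3"
    "24 * e4 = P 1 ^ 4 - 6 * P 1 ^ 2 * P 2 + 3 * P 2 ^ 2 + 8 * P 1 * P 3 - 6 * P 4"
    using newton_identities[of ?b m] unfolding P_def e2_def e3_def e4_def by (simp_all only: power_add)
  have "const_term ?b m k = - c" if "(\<Sum>x\<in>UNIV. trace p m (x ^ (card (UNIV :: 'a set) - 2) + a * x) ^ k) = c"
    "0 < k" "k \<le> 8" for k c
    using kloosterman_moment_const_term[OF assms(1) _ assms(3,4), of k a] that p17 by simp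
  note ct = this[OF kloosterman_moments(1)] this[OF kloosterman_moments(2)]
    this[OF kloosterman_moments(3)] this[OF kloosterman_moments(4)]
  have rel: "2 * P 1 = - 1" "12 * P 1 ^ 2 - 6 * P 2 = 5"
    "120 * P 1 ^ 3 - 180 * P 1 * P 2 + 80 * P 3 = - 61"
    "1680 * P 1 ^ 4 - 5040 * P 1 ^ 2 * P 2 + 1260 * P 2 ^ 2 + 4480 * P 1 * P 3 - 2310 * P 4 = 1385"
    using ct[OF assms(1) _ assms(4,5)] p17 const_term_power_sums[of ?b m]
    unfolding P_def by simp_all
  have cancel: "y = 0" if "c * y = 0" "c \<noteq> 0" for c y :: 'a
    using that by simp
  \<comment> \<open>The power sums are found in turn; elimination leaves a common factor (6, then
    16, then 2) that is nonzero in this characteristic.\<close>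
  have P2: "3 * P 2 = - 1"
  proof -
    have "6 * (3 * P 2 + 1) = 0"
      using rel(1,2) by algebra
    then show ?thesis
      using cancel[of 6 "3 * P 2 + 1"] nz by (simp add: eq_neg_iff_add_eq_0)
  qed
  have P3: "5 * P 3 = - 1"
  proof -
    have "16 * (5 * P 3 + 1) = 0"
      using rel(1,3) P2 by algebra
    then show ?thesis
      using cancel[of 16 "5 * P 3 + 1"] nz by (simp add: eq_neg_iff_add_eq_0)
  qed
  have P4: "1155 * P 4 = - 136"
  proof -
    have "2 * (1155 * P 4 + 136) = 0"
      using rel(1,4) P2 P3 by algebra
    then show ?thesis
      using cancel[of 2 "1155 * P 4 + 136"] nz by (simp add: eq_neg_iff_add_eq_0)
  qed
  have e2: "24 * e2 = 7"
    using newton(1) rel(1) P2 by algebra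
  have e3: "240 * e3 = - 41"
    using newton(2) rel(1) P2 P3 by algebra
  have e4: "88704 * e4 = 8879"
  proof -
    \<comment> \<open>\<open>5 * 88704\<close> is 24 times 18480, the common denominator of the
      terms of Newton's formula; their sum leaves a spare factor 5.\<close>
    have "5 * (88704 * e4 - 8879) = 0"
      using newton(3) rel(1) P2 P3 P4 by algebra
    then show ?thesis
      using cancel[of 5 "88704 * e4 - 8879"] nz by simp
  qed
  have divide: "y = d / c" if "c * y = d" "c \<noteq> 0" for c d y :: 'a
    using that by (auto simp: field_simps)
  have trace: "trace p m (a ^ r) = P r" for r
    by (simp add: trace_def P_def mult.commute flip: power_mult)
  have "P 1 = - (1 / 2)" "P 2 = - (1 / 3)" "P 3 = - (1 / 5)" "P 4 = - (136 / 1155)"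
    "e2 = 7 / 24" "e3 = - (41 / 240)" "e4 = 8879 / 88704"
    using divide[OF rel(1)] divide[OF P2] divide[OF P3] divide[OF P4] divide[OF e2] divide[OF e3] divide[OF e4] nz
    by simp_all
  moreover have "trace p m a = P 1"
    using trace[of 1] by simp
  ultimately show ?thesis
    by (simp only: trace e2_def[symmetric] e3_def[symmetric] e4_def[symmetric])
qed

end
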